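(* Let $(L,[-,-]_1,[-,-]_2)$ be a compatible Leibniz algebra over a field $\mathbb{K}$ such that the associated ternary Leibniz algebras $(L,\{x,y,z\}_1=[x,[y,z]_1]_1)$ and $(L,\{x,y,z\}_2=[x,[y,z]_2]_2)$ are compatible, and let $\beta:L\to L$ be an injective averaging operator on $L$ (for both brackets $[-,-]_1$ and $[-,-]_2$). For $i=1,2$ put $[x,y]_i^{\beta}:=[\beta(x),y]_i$. Then $(L,[-,[-,-]_1^{\beta}]_1^{\beta},[-,[-,-]_2^{\beta}]_2^{\beta})$, i.e. $L$ with the two ternary brackets $(x,y,z)\mapsto[x,[y,z]_i^{\beta}]_i^{\beta}$, $i=1,2$, is a compatible ternary Leibniz algebra.
   Context: A Leibniz algebra is a vector space $L$ with a bilinear bracket satisfying $[[x,y],z]=[x,[y,z]]+[[x,z],y]$. A compatible Leibniz algebra is a triple $(L,[-,-]_1,[-,-]_2)$ with both brackets Leibniz and $\lambda_1[-,-]_1+\lambda_2[-,-]_2$ a Leibniz bracket for all $\lambda_1,\lambda_2\in\mathbb{K}$. An averaging operator on a Leibniz algebra is a linear map $\beta$ with $\beta([\beta(x),y])=[\beta(x),\beta(y)]=\beta([x,\beta(y)])$ for all $x,y$. A ternary Leibniz algebra is a vector space with a trilinear bracket satisfying $\{\{x,y,z\},t,u\}=\{x,y,\{z,t,u\}\}+\{x,\{y,t,u\},z\}+\{\{x,t,u\},y,z\}$. For any Leibniz algebra, $(L,\{x,y,z\}:=[x,[y,z]])$ is a ternary Leibniz algebra, called the associated one. Two ternary Leibniz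 brackets on $L$ are compatible (and then form a compatible ternary Leibniz algebra) if for all $x,y,z,t,u$ \begin{align*} \{\{x,y,z\}_1,t,u\}_2+\{\{x,y,z\}_2,t,u\}_1&=\{x,y,\{z,t,u\}_1\}_2+\{x,y,\{z,t,u\}_2\}_1+\{x,\{y,t,u\}_1,z\}_2\\ &\quad+\{x,\{y,t,u\}_2,z\}_1+\{\{x,t,u\}_1,y,z\}_2+\{\{x,t,u\}_2,y,z\}_1. \end{align*} *)

theory Defs
  imports Main "HOL.Vector_Spaces"
begin

definition multilinear2 ::
  "('k::field \<Rightarrow> 'a::ab_group_add \<Rightarrow> 'a) \<Rightarrow> ('a \<Rightarrow> 'a \<Rightarrow> 'a) \<Rightarrow> bool" where
  "multilinear2 scale br \<longleftrightarrow>
     (\<forall>y. Vector_Spaces.linear scale scale (\<lambda>x. br x y)) \<and>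
     (\<forall>x. Vector_Spaces.linear scale scale (\<lambda>y. br x y))"

definition multilinear3 ::
  "('k::field \<Rightarrow> 'a::ab_group_add \<Rightarrow> 'a) \<Rightarrow> ('a \<Rightarrow> 'a \<Rightarrow> 'a \<Rightarrow> 'a) \<Rightarrow> bool" where
  "multilinear3 scale br \<longleftrightarrow>
     (\<forall>y z. Vector_Spaces.linear scale scale (\<lambda>x. br x y z)) \<and>
     (\<forall>x z. Vector_Spaces.linear scale scale (\<lambda>y. br x y z)) \<and>
     (\<forall>x y. Vector_Spaces.linear scale scale (\<lambda>z. br x y z))"

text \<open>The Leibniz identity is the right one: every right multiplication is a derivation.\<close>

locale leibniz_algebra = vector_space scale
  for scale :: "'k::field \<Rightarrow> 'a::ab_group_add \<Rightarrow> 'a" +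
  fixes br :: "'a \<Rightarrow> 'a \<Rightarrow> 'a"
  assumes bilinear: "multilinear2 scale br"
    and leibniz: "br (br x y) z = br x (br y z) + br (br x z) y"

locale compatible_leibniz_algebra =
  L1: leibniz_algebra scale br1 + L2: leibniz_algebra scale br2
  for scale :: "'k::field \<Rightarrow> 'a::ab_group_add \<Rightarrow> 'a"
    and br1 br2 :: "'a \<Rightarrow> 'a \<Rightarrow> 'a" +
  assumes combination:
    "leibniz_algebra scale (\<lambda>x y. scale l1 (br1 x y) + scale l2 (br2 x y))"

locale averaging_operator = leibniz_algebra scale br
  for scale :: "'k::field \<Rightarrow> 'a::ab_group_add \<Rightarrow> 'a"
    and br :: "'a \<Rightarrow> 'a \<Rightarrow> 'a" +
  fixes \<beta> :: "'a \<Rightarrow> 'a"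
  assumes linear: "Vector_Spaces.linear scale scale \<beta>"
    and averaging_left: "\<beta> (br (\<beta> x) y) = br (\<beta> x) (\<beta> y)"
    and averaging_right: "br (\<beta> x) (\<beta> y) = \<beta> (br x (\<beta> y))"

definition averaged_bracket ::
  "('a \<Rightarrow> 'a) \<Rightarrow> ('a \<Rightarrow> 'a \<Rightarrow> 'a) \<Rightarrow> 'a \<Rightarrow> 'a \<Rightarrow> 'a" where
  "averaged_bracket \<beta> br x y = br (\<beta> x) y"

locale ternary_leibniz_algebra = vector_space scale
  for scale :: "'k::field \<Rightarrow> 'a::ab_group_add \<Rightarrow> 'a" +
  fixes tr :: "'a \<Rightarrow> 'a \<Rightarrow> 'a \<Rightarrow> 'a"
  assumes trilinear: "multilinear3 scale tr"
    and ternary_leibniz: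
      "tr (tr x y z) t u = tr x y (tr z t u) + tr x (tr y t u) z + tr (tr x t u) y z"

definition associated_ternary ::
  "('a \<Rightarrow> 'a \<Rightarrow> 'a) \<Rightarrow> 'a \<Rightarrow> 'a \<Rightarrow> 'a \<Rightarrow> 'a" where
  "associated_ternary br x y z = br x (br y z)"

text \<open>Only the mixed identity between two brackets; that each bracket is itself
  ternary Leibniz is not part of this predicate.\<close>

definition ternary_brackets_compatible ::
  "('a::ab_group_add \<Rightarrow> 'a \<Rightarrow> 'a \<Rightarrow> 'a) \<Rightarrow> ('a \<Rightarrow> 'a \<Rightarrow> 'a \<Rightarrow> 'a) \<Rightarrow> bool" where
  "ternary_brackets_compatible tr1 tr2 \<longleftrightarrow>
     (\<forall>x y z t u.
        tr2 (tr1 x y z) t u + tr1 (tr2 x y z) t u =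
        tr2 x y (tr1 z t u) + tr1 x y (tr2 z t u) + tr2 x (tr1 y t u) z
        + tr1 x (tr2 y t u) z + tr2 (tr1 x t u) y z + tr1 (tr2 x t u) y z)"

locale compatible_ternary_leibniz_algebra =
  T1: ternary_leibniz_algebra scale tr1 + T2: ternary_leibniz_algebra scale tr2
  for scale :: "'k::field \<Rightarrow> 'a::ab_group_add \<Rightarrow> 'a"
    and tr1 tr2 :: "'a \<Rightarrow> 'a \<Rightarrow> 'a \<Rightarrow> 'a" +
  assumes compatible: "ternary_brackets_compatible tr1 tr2"

end

theory Submission
  imports Defs
begin

text \<open>
  Averaging says that \<open>\<beta> (br (\<beta> x) y) = br (\<beta> x) (\<beta> y)\<close>, that is, \<open>\<beta>\<close> is a homomorphism from
  the averaged bracket to the original one. Hence it is also a homomorphism from the ternary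
  bracket built from the averaged bracket to the associated ternary bracket of \<open>br\<close>, for both
  brackets at once. An injective homomorphism reflects every multilinear identity: both sides,
  pushed forward along \<open>\<beta>\<close>, become the same identity evaluated at images of \<open>\<beta>\<close>. So the ternary
  Leibniz identities and the compatibility identity descend from the associated ternary
  brackets to the averaged ones, and trilinearity descends in the same way. Injectivity enters
  as follows: before applying \<open>\<beta>\<close>, the Leibniz identity of \<open>br\<close> produces
  \<open>br (br (\<beta> x) z) (\<beta> y)\<close>, whereas the averaged bracket requires \<open>br (br (\<beta> x) (\<beta> z)) y\<close>;
  averaging alone identifies only the images of these two elements under \<open>\<beta>\<close>.
\<close>

text \<open>
  Right multiplication by \<open>br t u\<close> is a derivation of the binary bracket, so it acts as a
  derivation on the nested bracket as well, which is the ternary Leibniz identity.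
\<close>

lemma (in leibniz_algebra) ternary_leibniz_associated_ternary:
  "ternary_leibniz_algebra scale (associated_ternary br)"
proof
  have add_right: "br x (y + z) = br x y + br x z" for x y z
    using bilinear by (simp add: multilinear2_def linear_iff)
  have lin_left: "Vector_Spaces.linear scale scale (\<lambda>x. br x y)" for y
    using bilinear by (simp add: multilinear2_def)
  have lin_right: "Vector_Spaces.linear scale scale (br x)" for x
    using bilinear by (simp add: multilinear2_def)
  show "multilinear3 scale (associated_ternary br)"
    unfolding multilinear3_def associated_ternary_def
  proof (intro conjI allI)
    show "Vector_Spaces.linear scale scale (\<lambda>x. br x (br y z))" for y z
      by (rule lin_left)
    show "Vector_Spaces.linear scale scale (\<lambda>y. br x (br y z))" for x z
      using Vector_Spaces.linear_compose[OF lin_left[of z] lin_right[of x]] by (simp add: comp_def)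
    show "Vector_Spaces.linear scale scale (\<lambda>z. br x (br y z))" for x y
      using Vector_Spaces.linear_compose[OF lin_right[of y] lin_right[of x]] by (simp add: comp_def)
  qed
  show "associated_ternary br (associated_ternary br x y z) t u =
      associated_ternary br x y (associated_ternary br z t u)
      + associated_ternary br x (associated_ternary br y t u) z
      + associated_ternary br (associated_ternary br x t u) y z" for x y z t u
  proof -
    let ?D = "\<lambda>v. br v (br t u)"
    have "?D (br x (br y z)) = br x (?D (br y z)) + br (?D x) (br y z)"
      by (rule leibniz)
    also have "?D (br y z) = br y (?D z) + br (?D y) z"
      by (rule leibniz)
    finally show ?thesis
      by (simp add: associated_ternary_def add_right)
  qed
qed

lemma ternary_leibniz_reflected_by_injective_hom:
  assumes "ternary_leibniz_algebra scale tr"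
    and f: "Vector_Spaces.linear scale scale f" "inj f"
    and hom: "\<And>x y z. f (tr' x y z) = tr (f x) (f y) (f z)"
  shows "ternary_leibniz_algebra scale tr'"
proof -
  interpret ternary_leibniz_algebra scale tr by fact
  have f_add: "f (x + y) = f x + f y" and f_scale: "f (scale c x) = scale c (f x)" for c x y
    using f(1) by (simp_all add: linear_iff)
  have tr_linear:
    "tr (x + x') y z = tr x y z + tr x' y z" "tr (scale c x) y z = scale c (tr x y z)"
    "tr x (y + y') z = tr x y z + tr x y' z" "tr x (scale c y) z = scale c (tr x y z)"
    "tr x y (z + z') = tr x y z + tr x y z'" "tr x y (scale c z) = scale c (tr x y z)"
    for c x x' y y' z z'
    using trilinear by (simp_all add: multilinear3_def linear_iff)
  show ?thesis
  proof
    show "multilinear3 scale tr'"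
      unfolding multilinear3_def linear_iff
      by (intro conjI allI vector_space_axioms; rule injD[OF f(2)])
        (simp_all add: hom f_add f_scale tr_linear)
    show "tr' (tr' x y z) t u = tr' x y (tr' z t u) + tr' x (tr' y t u) z + tr' (tr' x t u) y z"
      for x y z t u
      by (rule injD[OF f(2)]) (simp only: hom f_add, rule ternary_leibniz)
  qed
qed

lemma ternary_compatibility_reflected_by_injective_hom:
  assumes compat: "ternary_brackets_compatible tr1 tr2"
    and add: "\<And>x y. f (x + y) = f x + f y" and "inj f"
    and hom: "\<And>x y z. f (tr1' x y z) = tr1 (f x) (f y) (f z)"
      "\<And>x y z. f (tr2' x y z) = tr2 (f x) (f y) (f z)"
  shows "ternary_brackets_compatible tr1' tr2'"
  unfolding ternary_brackets_compatible_def
proof (intro allI, rule injD[OF \<open>inj f\<close>])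
  fix x y z t u
  show "f (tr2' (tr1' x y z) t u + tr1' (tr2' x y z) t u) =
        f (tr2' x y (tr1' z t u) + tr1' x y (tr2' z t u) + tr2' x (tr1' y t u) z
        + tr1' x (tr2' y t u) z + tr2' (tr1' x t u) y z + tr1' (tr2' x t u) y z)"
    using compat[unfolded ternary_brackets_compatible_def, rule_format,
        of "f x" "f y" "f z" "f t" "f u"]
    by (simp add: hom add)
qed

lemma (in averaging_operator) averaged_ternary_hom:
  "\<beta> (averaged_bracket \<beta> br x (averaged_bracket \<beta> br y z)) =
    associated_ternary br (\<beta> x) (\<beta> y) (\<beta> z)"
  by (simp add: averaged_bracket_def associated_ternary_def averaging_left)

theorem corollary2p1:
  fixes scale :: "'k::field \<Rightarrow> 'a::ab_group_add \<Rightarrow> 'a"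
    and br1 br2 :: "'a \<Rightarrow> 'a \<Rightarrow> 'a"
    and \<beta> :: "'a \<Rightarrow> 'a"
  assumes "compatible_leibniz_algebra scale br1 br2"
    and "ternary_brackets_compatible (associated_ternary br1) (associated_ternary br2)"
    and "averaging_operator scale br1 \<beta>"
    and "averaging_operator scale br2 \<beta>"
    and "inj \<beta>"
  shows "compatible_ternary_leibniz_algebra scale
    (\<lambda>x y z. averaged_bracket \<beta> br1 x (averaged_bracket \<beta> br1 y z))
    (\<lambda>x y z. averaged_bracket \<beta> br2 x (averaged_bracket \<beta> br2 y z))"
proof -
  interpret A1: averaging_operator scale br1 \<beta> by fact
  interpret A2: averaging_operator scale br2 \<beta> by fact
  have add: "\<beta> (x + y) = \<beta> x + \<beta> y" for x y
    using A1.linear by (simp add: linear_iff)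
  define tr1 where "tr1 x y z = averaged_bracket \<beta> br1 x (averaged_bracket \<beta> br1 y z)" for x y z
  define tr2 where "tr2 x y z = averaged_bracket \<beta> br2 x (averaged_bracket \<beta> br2 y z)" for x y z
  have hom1: "\<beta> (tr1 x y z) = associated_ternary br1 (\<beta> x) (\<beta> y) (\<beta> z)" for x y z
    unfolding tr1_def by (rule A1.averaged_ternary_hom)
  have hom2: "\<beta> (tr2 x y z) = associated_ternary br2 (\<beta> x) (\<beta> y) (\<beta> z)" for x y z
    unfolding tr2_def by (rule A2.averaged_ternary_hom)
  have "ternary_leibniz_algebra scale tr1"
    by (rule ternary_leibniz_reflected_by_injective_hom
          [where tr = "associated_ternary br1" and f = \<beta>])
       (rule A1.ternary_leibniz_associated_ternary A1.linear \<open>inj \<beta>\<close> hom1)+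
  moreover have "ternary_leibniz_algebra scale tr2"
    by (rule ternary_leibniz_reflected_by_injective_hom
          [where tr = "associated_ternary br2" and f = \<beta>])
       (rule A2.ternary_leibniz_associated_ternary A2.linear \<open>inj \<beta>\<close> hom2)+
  moreover have "ternary_brackets_compatible tr1 tr2"
    by (rule ternary_compatibility_reflected_by_injective_hom
          [where ?tr1.0 = "associated_ternary br1" and ?tr2.0 = "associated_ternary br2" and f = \<beta>])
       (rule assms(2) add \<open>inj \<beta>\<close> hom1 hom2)+
  ultimately have "compatible_ternary_leibniz_algebra scale tr1 tr2"
    by (intro compatible_ternary_leibniz_algebra.intro
        compatible_ternary_leibniz_algebra_axioms.intro)
  then show ?thesis
    unfolding tr1_def[abs_def] tr2_def[abs_def] .
qed

end
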